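(* Let $A(x,v,w)=\sum_{n\ge2}\sum_{i=1}^n\sum_{j=1}^n a_n(i,j)v^iw^jx^n$ and $t(x)=\sqrt{(1-2q)^2x^2-2x(1+2q)+1}$. Then $$A(x,v,w)=\Bigl(wx+\frac{vqx}{1-v}\Bigr)A(x,vw,1)-\frac{v^2qx}{1-v}A(vx,w,1)+\frac{vw^2qx^2}{(1-v)(wqx-1)}A(vwx,1,1)-\frac{w^2qx^2}{(1-v)(wqx-1)}A(wx,v,1)+\frac{(vwq^2x-vq-w)vwx^2}{wqx-1},$$ where, with $P=vq^2x^2-vqx^2-qx+vx-v-x+1$, $$A(x,v,1)=\frac{xv(vqx-v-x)t(xv)}{2P(vqx-vx-1)}+\frac{\bigl(x+(qx^2+qx+3x^2-2x-1)v\bigr)vx}{2(vqx-vx-1)(vqx-1)P}-\frac{\bigl(2q^2x^2+3q^2x-qx^2-qx-3q+2x-1+(1-2q)(qx-1)vqx\bigr)v^3x^2}{2(vqx-vx-1)(vqx-1)P}+\frac{v^2qx^2}{1-vqx}.$$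
   Context: For $n\ge2$ and distinct $i,j\in[n]$, $a_n(i,j)=\sum q^{\mathrm{desc}(\pi)}$ over permutations $\pi$ of $[n]$ avoiding the patterns $1324$ and $1342$ with $\pi_1=i$, $\pi_2=j$ (and $a_n(i,i)=0$); $\mathrm{desc}$ counts descents. Square roots are formal power series with constant term $1$. *)

theory Defs
  imports
    "HOL-Computational_Algebra.Formal_Power_Series"
    "HOL-Combinatorics.Multiset_Permutations"
    "HOL-Library.Sublist"
begin

text \<open>
  A permutation \<open>\<pi>\<close> of \<open>[n]\<close> is its one-line notation, an element of
  \<open>permutations_of_set {1..n}\<close>. List positions start at 0, so \<open>\<pi>\<^sub>1\<close> is \<open>\<pi> ! 0\<close>
  and \<open>\<pi>\<^sub>2\<close> is \<open>\<pi> ! 1\<close>.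
\<close>

definition order_isomorphic :: "nat list \<Rightarrow> nat list \<Rightarrow> bool" where
  "order_isomorphic xs ys \<longleftrightarrow> length xs = length ys \<and>
     (\<forall>i<length xs. \<forall>j<length xs. xs ! i < xs ! j \<longleftrightarrow> ys ! i < ys ! j)"

definition avoids :: "nat list \<Rightarrow> nat list \<Rightarrow> bool" where
  "avoids \<pi> \<sigma> \<longleftrightarrow> \<not> (\<exists>xs. subseq xs \<pi> \<and> order_isomorphic xs \<sigma>)"

definition desc :: "nat list \<Rightarrow> nat" where
  "desc \<pi> = card {k. Suc k < length \<pi> \<and> \<pi> ! k > \<pi> ! Suc k}"

definition av_perms :: "nat \<Rightarrow> nat \<Rightarrow> nat \<Rightarrow> nat list set" where
  "av_perms n i j = {\<pi> \<in> permutations_of_set {1..n}.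
     avoids \<pi> [1, 3, 2, 4] \<and> avoids \<pi> [1, 3, 4, 2] \<and> \<pi> ! 0 = i \<and> \<pi> ! 1 = j}"

definition a :: "'a::comm_ring_1 \<Rightarrow> nat \<Rightarrow> nat \<Rightarrow> nat \<Rightarrow> 'a" where
  "a q n i j = (\<Sum>\<pi>\<in>av_perms n i j. q ^ desc \<pi>)"

text \<open>The convention \<open>a\<^sub>n(i,i) = 0\<close> holds because the sum is then empty.\<close>

lemma a_diag: "n \<ge> 2 \<Longrightarrow> a q n i i = 0"
proof -
  assume n: "n \<ge> 2"
  have "\<pi> ! 0 \<noteq> \<pi> ! 1" if "\<pi> \<in> permutations_of_set {1..n}" for \<pi>
  proof -
    from that have "distinct \<pi>" "length \<pi> = n"
      by (auto simp: permutations_of_set_def dest: distinct_card)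
    with n show ?thesis by (simp add: nth_eq_iff_index_eq)
  qed
  then have "\<pi> \<notin> av_perms n i i" for \<pi> unfolding av_perms_def by (metis (lifting) mem_Collect_eq)
  then have "av_perms n i i = {}" by blast
  then show ?thesis by (simp add: a_def)
qed

text \<open>
  \<open>A q v w\<close> is the series \<open>A(x,v,w)\<close> in the variable \<open>x = fps_X\<close>. The coefficient of
  each \<open>x\<^sup>n\<close> is a polynomial in \<open>q\<close>, \<open>v\<close>, \<open>w\<close>, so these are taken from an arbitrary
  coefficient ring. The three indeterminates are the special case of the generators of the
  rational function field \<open>rat poly poly poly fract\<close>. Substitutions for \<open>v\<close> and \<open>w\<close> are
  changes of argument. Substituting \<open>c x\<close> for \<open>x\<close> is the composition
  \<open>_ oo (fps_const c * fps_X)\<close>.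
\<close>

definition A :: "'a::comm_ring_1 \<Rightarrow> 'a \<Rightarrow> 'a \<Rightarrow> 'a fps" where
  "A q v w = Abs_fps (\<lambda>n. if n \<ge> 2
     then (\<Sum>i=1..n. \<Sum>j=1..n. a q n i j * v ^ i * w ^ j) else 0)"

text \<open>
  The function argument of \<open>fps_radical\<close> prescribes the root of the constant term, here 1.
  So this is the intended square root only for series with constant term 1.
\<close>

definition fps_sqrt :: "'a::field_char_0 fps \<Rightarrow> 'a fps" where
  "fps_sqrt f = fps_radical (\<lambda>_ _. 1) 2 f"

lemma fps_sqrt_iff:
  assumes "fps_nth f 0 = 1"
  shows "s = fps_sqrt f \<longleftrightarrow> s ^ 2 = f \<and> fps_nth s 0 = 1"
proof -
  have "fps_nth s 0 = 1" if "s = fps_sqrt f"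
    using that by (simp add: fps_sqrt_def)
  moreover have "s ^ 2 = f \<longleftrightarrow> s = fps_sqrt f" if "fps_nth s 0 = 1"
    using radical_unique[of "\<lambda>_ _. 1" 1 f s] assms that
    by (simp add: fps_sqrt_def numeral_2_eq_2)
  ultimately show ?thesis by blast
qed

definition t :: "'a::field_char_0 \<Rightarrow> 'a fps" where
  "t q = fps_sqrt (fps_const ((1 - 2 * q)\<^sup>2) * fps_X\<^sup>2
     - 2 * fps_X * fps_const (1 + 2 * q) + 1)"

end

theory Submission
  imports Defs
begin

text \<open>
  A permutation avoids 1324 and 1342 iff, for every entry \<open>i\<close>, the later entries exceeding \<open>i\<close>
  avoid 213 and 231, that is, each of them is the minimum or the maximum of those from it on.
  Hence if \<open>\<pi>\<close> starts with \<open>i, j\<close>, then \<open>j < i\<close>, \<open>j = i + 1\<close> or \<open>j = n\<close>; in the first two cases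
  \<open>i\<close> can be deleted, in the last one \<open>n\<close>. With \<open>F\<^sub>n(i) = \<Sum>\<^sub>j a\<^sub>n(i,j)\<close> this expresses \<open>a\<^sub>n\<close> in terms of
  \<open>F\<^sub>n\<^sub>-\<^sub>1\<close> and \<open>F\<^sub>n\<^sub>-\<^sub>2\<close>. Summation gives a functional equation for \<open>A(x,v,w)\<close>, and for \<open>w = 1\<close>, with
  \<open>\<Psi>(x,v) = A(x,v,1) + vx\<close> and \<open>S(x) = \<Psi>(x,1)\<close>, the kernel equation
  \<open>P \<Psi>(x,v) = (1 - v)vx(1 - qx) - qxv(v + x - vqx) S(vx)\<close>.
  The kernel \<open>P\<close> is linear in \<open>v\<close> and vanishes at a power series \<open>u(x)\<close>, where the equation reduces
  to \<open>S(x u(x)) = x / (1 - x)\<close>. Eliminating \<open>x\<close> on the right-hand side gives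
  \<open>(q + q(1 - q)x)S\<^sup>2 - (1 - x)S + x = 0\<close>, whose discriminant is \<open>t\<^sup>2\<close>. The first identity is a combination
  of the functional equation and the kernel equation at \<open>wx\<close>.
\<close>

section \<open>Recursive description of avoidance\<close>

text \<open>Avoidance of 213 and 231: both patterns start with their middle value, so an occurrence
  is an entry followed, in either order, by a smaller and a larger one.\<close>

fun extremal :: "nat list \<Rightarrow> bool" where
  "extremal [] \<longleftrightarrow> True"
| "extremal (y # ys) \<longleftrightarrow> extremal ys \<and> \<not> (\<exists>z\<in>set ys. \<exists>z'\<in>set ys. z < y \<and> y < z')"

text \<open>Both 1324 and 1342 start with their least value, and the rest is order isomorphic to 213
  or 231. So an occurrence starting at \<open>x\<close> is one of these among the later entries
  above \<open>x\<close>.\<close>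

fun avoiding :: "nat list \<Rightarrow> bool" where
  "avoiding [] \<longleftrightarrow> True"
| "avoiding (x # xs) \<longleftrightarrow> avoiding xs \<and> extremal (filter (\<lambda>y. x < y) xs)"

lemma subseq_filter_iff: "subseq xs (filter P ys) \<longleftrightarrow> subseq xs ys \<and> (\<forall>x\<in>set xs. P x)"
proof
  assume h: "subseq xs (filter P ys)"
  then have "set xs \<subseteq> set (filter P ys)"
    by (metis notin_set_nthsI subseq_conv_nths subsetI)
  moreover have "subseq xs ys" 
    using h subseq_filter_left subseq_order.order_trans by blast
  ultimately show "subseq xs ys \<and> (\<forall>x\<in>set xs. P x)" by auto
next
  assume h: "subseq xs ys \<and> (\<forall>x\<in>set xs. P x)"
  then have "filter P xs = xs" by (simp add: filter_id_conv)
  with h show "subseq xs (filter P ys)" by (metis subseq_filter)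
qed

lemma subseq_pair_or: 
  "z \<in> set xs \<Longrightarrow> z' \<in> set xs \<Longrightarrow> z \<noteq> z' \<Longrightarrow> subseq [z, z'] xs \<or> subseq [z', z] xs"
  by (induction xs) (auto simp: subseq_singleton_left)

lemma subseq_pair_set: "subseq [z, z'] xs \<Longrightarrow> z \<in> set xs \<and> z' \<in> set xs"
  by (metis list.set_intros notin_set_nthsI subseq_conv_nths)

lemma not_extremal_iff:
  "\<not> extremal xs \<longleftrightarrow> (\<exists>b c d. subseq [b, c, d] xs \<and> (c < b \<and> b < d \<or> d < b \<and> b < c))"
proof (induction xs)
  case (Cons y ys)
  have "(\<exists>z\<in>set ys. \<exists>z'\<in>set ys. z < y \<and> y < z') \<longleftrightarrow>
      (\<exists>c d. subseq [c, d] ys \<and> (c < y \<and> y < d \<or> d < y \<and> y < c))" (is "?L \<longleftrightarrow> ?R")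
  proof
    assume ?L
    then obtain z z' where z: "z \<in> set ys" "z' \<in> set ys" "z < y" "y < z'" by blast
    then have "subseq [z, z'] ys \<or> subseq [z', z] ys" by (intro subseq_pair_or) auto
    with z show ?R by blast
  next
    assume ?R then show ?L by (meson subseq_pair_set)
  qed
  moreover have "subseq [b, c, d] (y # ys) \<longleftrightarrow> subseq [b, c, d] ys \<or> b = y \<and> subseq [c, d] ys" for b c d
    by (auto dest: subseq_Cons')
  ultimately show ?case using Cons.IH by (simp only: extremal.simps) blast
qed simp

lemma not_avoiding_iff:
  "\<not> avoiding xs \<longleftrightarrow>
    (\<exists>a b c d. subseq [a, b, c, d] xs \<and> (a < c \<and> c < b \<and> b < d \<or> a < d \<and> d < b \<and> b < c))"
proof (induction xs)
  case (Cons x xs)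
  have "\<not> extremal (filter (\<lambda>y. x < y) xs) \<longleftrightarrow>
      (\<exists>b c d. subseq [b, c, d] xs \<and> (x < c \<and> c < b \<and> b < d \<or> x < d \<and> d < b \<and> b < c))"
    unfolding not_extremal_iff subseq_filter_iff by (intro ex_cong1) auto
  moreover have "subseq [a, b, c, d] (x # xs) \<longleftrightarrow>
      subseq [a, b, c, d] xs \<or> a = x \<and> subseq [b, c, d] xs" for a b c d
    by (auto dest: subseq_Cons')
  ultimately show ?case using Cons.IH by (simp only: avoiding.simps) blast
qed simp

lemma length_4_conv: "length xs = 4 \<longleftrightarrow> (\<exists>a b c d. xs = [a, b, c, d])"
  by (auto simp: eval_nat_numeral length_Suc_conv)

lemma order_isomorphic_1324:
  "order_isomorphic xs [1, 3, 2, 4] \<longleftrightarrow> (\<exists>a b c d. xs = [a, b, c, d] \<and> a < c \<and> c < b \<and> b < d)"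
proof -
  have "order_isomorphic [a, b, c, d] [1, 3, 2, 4] \<longleftrightarrow> a < c \<and> c < b \<and> b < d" for a b c d
    by (simp add: order_isomorphic_def All_less_Suc2 numeral_eq_Suc) linarith
  moreover have "order_isomorphic xs [1, 3, 2, 4] \<Longrightarrow> length xs = 4"
    by (simp add: order_isomorphic_def)
  ultimately show ?thesis by (auto simp: length_4_conv)
qed

lemma order_isomorphic_1342:
  "order_isomorphic xs [1, 3, 4, 2] \<longleftrightarrow> (\<exists>a b c d. xs = [a, b, c, d] \<and> a < d \<and> d < b \<and> b < c)"
proof -
  have "order_isomorphic [a, b, c, d] [1, 3, 4, 2] \<longleftrightarrow> a < d \<and> d < b \<and> b < c" for a b c d
    by (simp add: order_isomorphic_def All_less_Suc2 numeral_eq_Suc) linarith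
  moreover have "order_isomorphic xs [1, 3, 4, 2] \<Longrightarrow> length xs = 4"
    by (simp add: order_isomorphic_def)
  ultimately show ?thesis by (auto simp: length_4_conv)
qed

lemma avoids_iff_avoiding:
  "avoids xs [1, 3, 2, 4] \<and> avoids xs [1, 3, 4, 2] \<longleftrightarrow> avoiding xs"
  using not_avoiding_iff[of xs]
  unfolding avoids_def order_isomorphic_1324 order_isomorphic_1342 by blast

section \<open>Order-preserving relabelling and descents\<close>

lemma extremal_map: "strict_mono f \<Longrightarrow> extremal (map f xs) \<longleftrightarrow> extremal xs"
  by (induction xs) (auto simp: strict_mono_less)

lemma avoiding_map: "strict_mono f \<Longrightarrow> avoiding (map f xs) \<longleftrightarrow> avoiding xs"
  by (induction xs) (auto simp: strict_mono_less filter_map o_def extremal_map)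

lemma extremal_filter: "extremal xs \<Longrightarrow> extremal (filter P xs)"
  by (induction xs) auto

lemma desc_Nil [simp]: "desc [] = 0" and desc_singleton [simp]: "desc [x] = 0"
  by (simp_all add: desc_def)

lemma desc_Cons_Cons [simp]:
  "desc (x # y # ys) = (if y < x then 1 else 0) + desc (y # ys)"
proof -
  define S where "S xs = {k. Suc k < length xs \<and> xs ! k > xs ! Suc k}" for xs :: "nat list"
  have "k \<in> S (x # y # ys) \<longleftrightarrow> k \<in> (if y < x then {0} else {}) \<union> Suc ` S (y # ys)" for k
    by (cases k) (auto simp: S_def)
  then have "S (x # y # ys) = (if y < x then {0} else {}) \<union> Suc ` S (y # ys)" by blast
  moreover have "finite (S (y # ys))"
    by (rule finite_subset[of _ "{..<length (y # ys)}"]) (auto simp: S_def)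
  ultimately have "card (S (x # y # ys)) = (if y < x then 1 else 0) + card (S (y # ys))"
    by (simp add: card_image card_insert_if image_iff)
  then show ?thesis by (simp only: desc_def S_def)
qed

lemma desc_map: "strict_mono f \<Longrightarrow> desc (map f xs) = desc xs"
  by (induction xs rule: induct_list012) (auto simp: strict_mono_less)

section \<open>Permutations with a prescribed first entry\<close>

definition headed :: "nat \<Rightarrow> nat \<Rightarrow> nat list set" where
  "headed n i = {\<pi> \<in> permutations_of_set {1..n}. avoiding \<pi> \<and> \<pi> \<noteq> [] \<and> hd \<pi> = i}"

text \<open>Prescribing the first entry alone makes sense also for \<open>n = 1\<close>, where there
  is no second entry and where the recursion starts.\<close>

definition F :: "'a::comm_ring_1 \<Rightarrow> nat \<Rightarrow> nat \<Rightarrow> 'a" where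
  "F q n i = (\<Sum>\<pi>\<in>headed n i. q ^ desc \<pi>)"

lemma mem_headed:
  "\<pi> \<in> headed n i \<longleftrightarrow> (\<exists>\<rho>. \<pi> = i # \<rho> \<and> set (i # \<rho>) = {1..n} \<and> distinct (i # \<rho>) \<and> avoiding (i # \<rho>))"
  unfolding headed_def permutations_of_set_def by (cases \<pi>) auto

lemma finite_headed [simp]: "finite (headed n i)"
  unfolding headed_def by simp

lemma mem_av_perms:
  assumes "n \<ge> 2"
  shows "\<pi> \<in> av_perms n i j \<longleftrightarrow> (\<exists>\<rho>. \<pi> = i # j # \<rho> \<and> set (i # j # \<rho>) = {1..n} \<and> 
    distinct (i # j # \<rho>) \<and> avoiding (i # j # \<rho>))" (is "?L \<longleftrightarrow> ?R")
proof
  assume h: ?L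
  then have "distinct \<pi>" "set \<pi> = {1..n}" 
    by (auto simp: av_perms_def permutations_of_set_def)
  then have "length \<pi> = n" using distinct_card by fastforce
  with assms obtain i' j' \<rho> where "\<pi> = i' # j' # \<rho>"
    by (metis (no_types, lifting) Suc_le_length_iff numeral_2_eq_2)
  moreover have "avoiding \<pi>" "\<pi> ! 0 = i" "\<pi> ! 1 = j"
    using h by (simp_all add: av_perms_def avoids_iff_avoiding[symmetric])
  ultimately show ?R using \<open>distinct \<pi>\<close> \<open>set \<pi> = {1..n}\<close>
    by (simp del: avoiding.simps list.set distinct.simps)
next
  assume ?R
  then obtain \<rho> where "\<pi> = i # j # \<rho>" "set \<pi> = {1..n}" "distinct \<pi>" "avoiding \<pi>"
    by blast
  then show ?L
    by (simp add: av_perms_def permutations_of_set_def avoids_iff_avoiding[symmetric])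
qed

lemma headed_eq_UN: 
  assumes "n \<ge> 2"
  shows "headed n i = (\<Union>j\<in>{1..n}. av_perms n i j)"
proof (intro set_eqI iffI)
  fix \<pi> assume "\<pi> \<in> headed n i"
  then obtain \<rho> where r: "\<pi> = i # \<rho>" "set (i # \<rho>) = {1..n}" "distinct (i # \<rho>)" "avoiding (i # \<rho>)"
    unfolding mem_headed by blast
  have "\<rho> \<noteq> []"
  proof
    assume "\<rho> = []"
    then have "card {1..n} = 1" using r(2) by (metis card_1_singleton_iff list.set(1,2) One_nat_def)
    with assms show False by simp
  qed
  then obtain j \<rho>' where j: "\<rho> = j # \<rho>'" by (cases \<rho>) auto
  with r have "\<pi> \<in> av_perms n i j" using mem_av_perms[OF assms] by blast
  moreover from r(2) j have "j \<in> {1..n}" by auto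
  ultimately show "\<pi> \<in> (\<Union>j\<in>{1..n}. av_perms n i j)" by blast
next
  fix \<pi> assume "\<pi> \<in> (\<Union>j\<in>{1..n}. av_perms n i j)"
  then show "\<pi> \<in> headed n i" using mem_av_perms[OF assms] unfolding mem_headed by blast
qed

lemma F_eq_sum_a:
  assumes "n \<ge> 2"
  shows "F q n i = (\<Sum>j=1..n. a q n i j)"
  unfolding F_def a_def headed_eq_UN[OF assms]
proof (rule sum.UNION_disjoint)
  show "\<forall>j\<in>{1..n}. finite (av_perms n i j)" by (simp add: av_perms_def)
  show "\<forall>j\<in>{1..n}. \<forall>j'\<in>{1..n}. j \<noteq> j' \<longrightarrow> av_perms n i j \<inter> av_perms n i j' = {}"
    by (auto simp: av_perms_def)
qed simp

lemma headed_range: "\<pi> \<in> headed n i \<Longrightarrow> i \<in> {1..n}"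
  by (metis mem_headed list.set_intros(1))

lemma F_outside: "i \<notin> {1..n} \<Longrightarrow> F q n i = 0"
  unfolding F_def by (rule sum.neutral) (use headed_range in blast)

lemma F_1_1: "F q 1 1 = 1"
proof -
  have "\<pi> \<in> headed 1 1 \<longleftrightarrow> \<pi> = [1]" for \<pi>
  proof
    assume "\<pi> \<in> headed 1 1"
    then obtain \<rho> where "\<pi> = 1 # \<rho>" "set \<rho> \<subseteq> {1}" "1 \<notin> set \<rho>"
      unfolding mem_headed by auto
    then show "\<pi> = [1]" by (cases \<rho>) auto
  qed (auto simp: mem_headed)
  then have "headed 1 1 = {[1]}" by blast
  then show ?thesis by (simp add: F_def)
qed

section \<open>Deleting one of the first two entries\<close>

text \<open>The increasing bijection from the naturals onto those different from \<open>i\<close>;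
  it makes room for a new entry \<open>i\<close>.\<close>

definition shift :: "nat \<Rightarrow> nat \<Rightarrow> nat" where
  "shift i y = (if y < i then y else Suc y)"

lemma strict_mono_shift: "strict_mono (shift i)"
  by (auto simp: strict_mono_def shift_def)

lemma inj_shift: "inj (shift i)"
  by (auto simp: inj_def shift_def split: if_splits)

lemma shift_neq [simp]: "shift i y \<noteq> i"
  by (simp add: shift_def)

lemma shift_surj: "y \<noteq> i \<Longrightarrow> \<exists>z. y = shift i z"
  by (rule exI[of _ "if y < i then y else y - 1"]) (auto simp: shift_def)

lemma shift_image:
  assumes "1 \<le> i" "i \<le> Suc m"
  shows "shift i ` {1..m} = {1..Suc m} - {i}"
proof
  show "shift i ` {1..m} \<subseteq> {1..Suc m} - {i}" using assms by (auto simp: shift_def)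
  show "{1..Suc m} - {i} \<subseteq> shift i ` {1..m}"
  proof
    fix y assume y: "y \<in> {1..Suc m} - {i}"
    then obtain z where z: "y = shift i z" using shift_surj by blast
    with y assms have "z \<in> {1..m}" by (auto simp: shift_def split: if_splits)
    with z show "y \<in> shift i ` {1..m}" by blast
  qed
qed

lemma map_shift_surj: "i \<notin> set xs \<Longrightarrow> \<exists>ys. xs = map (shift i) ys"
proof (induction xs)
  case (Cons x xs)
  then obtain ys z where "xs = map (shift i) ys" "x = shift i z" 
    using shift_surj by fastforce
  then show ?case by (metis list.simps(9))
qed simp

text \<open>If \<open>j < i\<close>, the entries above \<open>i\<close> form a sublist of those
  above \<open>j\<close>, and extremality passes to sublists. If \<open>j = i + 1\<close>, then
  \<open>j\<close> is the minimum of the entries above \<open>i\<close>, and the others are exactly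
  those above \<open>j\<close>.\<close>

lemma extremal_filter_ge:
  assumes "avoiding (j # \<rho>)" "j < i \<or> j = Suc i \<and> j \<notin> set \<rho>"
  shows "extremal (filter (\<lambda>y. i < y) (j # \<rho>))"
  using assms(2)
proof
  assume "j < i"
  then have "filter (\<lambda>y. i < y) (j # \<rho>) = filter (\<lambda>y. i < y) (filter (\<lambda>y. j < y) \<rho>)"
    by (auto intro: filter_cong)
  with assms(1) show ?thesis by (simp add: extremal_filter del: filter_filter)
next
  assume j: "j = Suc i \<and> j \<notin> set \<rho>"
  then have "filter (\<lambda>y. i < y) \<rho> = filter (\<lambda>y. j < y) \<rho>"
    by (intro filter_cong) (auto, metis Suc_lessI)
  with j assms(1) show ?thesis by auto
qed

text \<open>
  If \<open>j \<le> i + 1\<close>, every forbidden pattern starting at the first entry \<open>i\<close> yields one starting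
  at the second entry \<open>j\<close>, so \<open>i\<close> can be deleted.
\<close>

lemma bij_betw_prepend:
  assumes i: "1 \<le> i" "i \<le> Suc m" and k: "k \<le> i" and m: "1 \<le> m"
  shows "bij_betw (\<lambda>\<sigma>. i # map (shift i) \<sigma>) (headed m k) (av_perms (Suc m) i (shift i k))"
proof (rule bij_betw_imageI)
  have n: "2 \<le> Suc m" using m by simp
  show "inj_on (\<lambda>\<sigma>. i # map (shift i) \<sigma>) (headed m k)"
    by (rule inj_onI) (use inj_shift inj_map_eq_map in force)
  show "(\<lambda>\<sigma>. i # map (shift i) \<sigma>) ` headed m k = av_perms (Suc m) i (shift i k)"
  proof (intro set_eqI iffI)
    fix \<pi> assume "\<pi> \<in> (\<lambda>\<sigma>. i # map (shift i) \<sigma>) ` headed m k"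
    then obtain \<sigma> where "\<pi> = i # map (shift i) \<sigma>" "\<sigma> \<in> headed m k" by blast
    then obtain \<rho> where p: "\<pi> = i # map (shift i) (k # \<rho>)" and
      r: "set (k # \<rho>) = {1..m}" "distinct (k # \<rho>)" "avoiding (k # \<rho>)"
      unfolding mem_headed by blast
    have s: "set (map (shift i) (k # \<rho>)) = {1..Suc m} - {i}"
      using shift_image[OF i] r(1) by (simp only: set_map)
    then have "set \<pi> = {1..Suc m}" using i by (simp only: p list.set(2)) auto
    moreover have "distinct (map (shift i) (k # \<rho>))"
      using r(2) by (metis distinct_map inj_shift inj_on_subset subset_UNIV)
    moreover from this have "distinct \<pi>" using s by (simp only: p distinct.simps) blast
    moreover have av: "avoiding (map (shift i) (k # \<rho>))"
      using r(3) by (simp only: avoiding_map[OF strict_mono_shift])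
    \<comment> \<open>The second entry \<open>shift i k\<close> is \<open>k\<close> if
      \<open>k < i\<close> and \<open>i + 1\<close> if \<open>k = i\<close>: the two cases in which
      the new first entry starts no occurrence.\<close>
    moreover have "extremal (filter (\<lambda>y. i < y) (map (shift i) (k # \<rho>)))"
      using av \<open>distinct (map (shift i) (k # \<rho>))\<close> k unfolding list.map(2)
      by (intro extremal_filter_ge) (auto simp: shift_def)
    ultimately show "\<pi> \<in> av_perms (Suc m) i (shift i k)"
      unfolding mem_av_perms[OF n] p list.map(2) by (simp only: avoiding.simps) blast
  next
    fix \<pi> assume "\<pi> \<in> av_perms (Suc m) i (shift i k)"
    then obtain \<rho> where p: "\<pi> = i # shift i k # \<rho>" and
      r: "set (i # shift i k # \<rho>) = {1..Suc m}" "distinct (i # shift i k # \<rho>)"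
        "avoiding (i # shift i k # \<rho>)"
      unfolding mem_av_perms[OF n] by blast
    from r(2) have "i \<notin> set \<rho>" by simp
    then obtain \<tau> where t: "\<rho> = map (shift i) \<tau>" using map_shift_surj by blast
    have "shift i ` set (k # \<tau>) = {1..Suc m} - {i}"
      using r(1,2) unfolding t by auto
    then have "set (k # \<tau>) = {1..m}"
      using shift_image[OF i] inj_image_eq_iff[OF inj_shift] by metis
    moreover have "distinct (k # \<tau>)" 
      using r(2) unfolding t by (auto simp: distinct_map)
    moreover have "avoiding (map (shift i) (k # \<tau>))"
      using r(3) unfolding t list.map(2) by (simp only: avoiding.simps)
    then have "avoiding (k # \<tau>)" by (simp only: avoiding_map[OF strict_mono_shift])
    ultimately have "k # \<tau> \<in> headed m k" unfolding mem_headed by blast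
    moreover have "\<pi> = i # map (shift i) (k # \<tau>)" by (simp add: p t)
    ultimately show "\<pi> \<in> (\<lambda>\<sigma>. i # map (shift i) \<sigma>) ` headed m k" by blast
  qed
qed

lemma desc_prepend:
  assumes "\<sigma> \<in> headed m k" "k \<le> i"
  shows "desc (i # map (shift i) \<sigma>) = (if k < i then 1 else 0) + desc \<sigma>"
proof -
  from assms obtain \<rho> where s: "\<sigma> = k # \<rho>" unfolding mem_headed by blast
  have "desc (i # map (shift i) \<sigma>) = (if shift i k < i then 1 else 0) + desc (map (shift i) \<sigma>)"
    by (simp add: s)
  moreover have "shift i k < i \<longleftrightarrow> k < i" by (simp add: shift_def)
  ultimately show ?thesis by (simp add: desc_map[OF strict_mono_shift])
qed

lemma a_prepend:
  assumes "1 \<le> i" "i \<le> Suc m" "k \<le> i" "1 \<le> m"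
  shows "a q (Suc m) i (shift i k) = (if k < i then q else 1) * F q m k"
proof -
  have "a q (Suc m) i (shift i k) = (\<Sum>\<sigma>\<in>headed m k. q ^ desc (i # map (shift i) \<sigma>))"
    unfolding a_def by (rule sum.reindex_bij_betw[OF bij_betw_prepend[OF assms], symmetric])
  also have "\<dots> = (\<Sum>\<sigma>\<in>headed m k. (if k < i then q else 1) * q ^ desc \<sigma>)"
    using assms(3) by (intro sum.cong) (auto simp: desc_prepend)
  finally show ?thesis by (simp add: F_def sum_distrib_left)
qed

lemma a_descent: "1 \<le> i \<Longrightarrow> i \<le> Suc m \<Longrightarrow> j < i \<Longrightarrow> 1 \<le> m \<Longrightarrow> a q (Suc m) i j = q * F q m j"
  using a_prepend[of i m j q] by (simp add: shift_def)

lemma a_succ: "1 \<le> i \<Longrightarrow> i \<le> m \<Longrightarrow> a q (Suc m) i (Suc i) = F q m i"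
  using a_prepend[of i m i q] by (simp add: shift_def)

text \<open>The entries \<open>i + 1\<close> and \<open>n\<close> both come after \<open>j\<close>
  and enclose it in value, so together with \<open>i\<close> and \<open>j\<close> they form 1324 or
  1342, according to their order.\<close>

lemma a_middle:
  assumes "2 \<le> n" "Suc i < j" "j < n"
  shows "a q n i j = 0"
proof -
  have "\<pi> \<notin> av_perms n i j" for \<pi>
  proof
    assume "\<pi> \<in> av_perms n i j"
    then obtain \<rho> where
      r: "set (i # j # \<rho>) = {1..n}" "distinct (i # j # \<rho>)" "avoiding (i # j # \<rho>)"
      unfolding mem_av_perms[OF assms(1)] by blast
    have "Suc i \<in> set (i # j # \<rho>)" "n \<in> set (i # j # \<rho>)" using assms unfolding r(1) by auto
    with assms have f: "Suc i \<in> set (filter (\<lambda>y. i < y) \<rho>)" "n \<in> set (filter (\<lambda>y. i < y) \<rho>)" by auto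
    have "filter (\<lambda>y. i < y) (j # \<rho>) = j # filter (\<lambda>y. i < y) \<rho>" using assms by simp
    with r(3) have "extremal (j # filter (\<lambda>y. i < y) \<rho>)" by (metis avoiding.simps(2))
    with f assms(2,3) show False unfolding extremal.simps by blast
  qed
  then show ?thesis unfolding a_def by (blast intro: sum.neutral)
qed

text \<open>The maximum could only play the 4 of a pattern, but in both patterns at least two
  entries precede the 4, whereas only \<open>i\<close> precedes \<open>n\<close> here.\<close>

lemma avoiding_insert_max:
  assumes "i < n" "\<forall>y\<in>set \<rho>. y < n"
  shows "avoiding (i # n # \<rho>) \<longleftrightarrow> avoiding (i # \<rho>)"
proof -
  have "filter (\<lambda>y. n < y) \<rho> = []" using assms(2) by (auto simp: filter_empty_conv)
  with assms show ?thesis by auto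
qed

lemma bij_betw_insert_max:
  assumes i: "1 \<le> i" "i \<le> m"
  shows "bij_betw (\<lambda>\<sigma>. i # Suc m # tl \<sigma>) (headed m i) (av_perms (Suc m) i (Suc m))"
proof (rule bij_betw_imageI)
  have n: "2 \<le> Suc m" using i by simp
  show "inj_on (\<lambda>\<sigma>. i # Suc m # tl \<sigma>) (headed m i)"
    by (rule inj_onI) (auto simp: mem_headed)
  show "(\<lambda>\<sigma>. i # Suc m # tl \<sigma>) ` headed m i = av_perms (Suc m) i (Suc m)"
  proof (intro set_eqI iffI)
    fix \<pi> assume "\<pi> \<in> (\<lambda>\<sigma>. i # Suc m # tl \<sigma>) ` headed m i"
    then obtain \<sigma> where "\<pi> = i # Suc m # tl \<sigma>" "\<sigma> \<in> headed m i" by blast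
    then obtain \<rho> where p: "\<pi> = i # Suc m # \<rho>" and
      r: "set (i # \<rho>) = {1..m}" "distinct (i # \<rho>)" "avoiding (i # \<rho>)"
      unfolding mem_headed by (metis list.sel(3))
    have lt: "\<forall>y\<in>set (i # \<rho>). y < Suc m" unfolding r(1) by auto
    have "set \<pi> = insert (Suc m) (set (i # \<rho>))" by (auto simp: p)
    also have "\<dots> = {1..Suc m}" unfolding r(1) by auto
    finally have "set \<pi> = {1..Suc m}" .
    moreover have "distinct \<pi>" using r(2) lt by (auto simp: p)
    moreover have "avoiding \<pi>" using r(3) lt by (simp add: p avoiding_insert_max del: avoiding.simps)
    ultimately show "\<pi> \<in> av_perms (Suc m) i (Suc m)" unfolding mem_av_perms[OF n] p by blast
  next
    fix \<pi> assume "\<pi> \<in> av_perms (Suc m) i (Suc m)"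
    then obtain \<rho> where p: "\<pi> = i # Suc m # \<rho>" and
      r: "set (i # Suc m # \<rho>) = {1..Suc m}" "distinct (i # Suc m # \<rho>)"
        "avoiding (i # Suc m # \<rho>)"
      unfolding mem_av_perms[OF n] by blast
    have "set (i # \<rho>) = set (i # Suc m # \<rho>) - {Suc m}" using r(2) by auto
    also have "\<dots> = {1..m}" unfolding r(1) by auto
    finally have s: "set (i # \<rho>) = {1..m}" .
    then have "\<forall>y\<in>set (i # \<rho>). y < Suc m" by auto
    with r(3) have "avoiding (i # \<rho>)" by (simp add: avoiding_insert_max del: avoiding.simps)
    with s r(2) have "i # \<rho> \<in> headed m i" unfolding mem_headed by auto
    with p show "\<pi> \<in> (\<lambda>\<sigma>. i # Suc m # tl \<sigma>) ` headed m i" by force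
  qed
qed

text \<open>Inserting \<open>m + 1\<close> between \<open>i\<close> and the next entry
  \<open>k\<close> creates a descent from \<open>m + 1\<close> to \<open>k\<close> and removes the
  possible one from \<open>i\<close> to \<open>k\<close>. So the number of descents is unchanged if
  \<open>k < i\<close> and grows by 1 otherwise.\<close>

lemma a_max:
  assumes i: "1 \<le> i" "i \<le> m" and m: "2 \<le> m"
  shows "a q (Suc m) i (Suc m) = q * F q m i + (1 - q) * q * (\<Sum>k=1..<i. F q (m - 1) k)"
proof -
  have "a q (Suc m) i (Suc m) = (\<Sum>\<sigma>\<in>headed m i. q ^ desc (i # Suc m # tl \<sigma>))"
    unfolding a_def by (rule sum.reindex_bij_betw[OF bij_betw_insert_max[OF i], symmetric])
  also have "\<dots> = (\<Sum>k=1..m. \<Sum>\<sigma>\<in>av_perms m i k. q ^ desc (i # Suc m # tl \<sigma>))"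
    unfolding headed_eq_UN[OF m] by (rule sum.UNION_disjoint) (auto simp: av_perms_def)
  also have "\<dots> = (\<Sum>k=1..m. (if k < i then 1 else q) * a q m i k)"
  proof (rule sum.cong[OF refl])
    fix k assume k: "k \<in> {1..m}"
    have "desc (i # Suc m # tl \<sigma>) = desc \<sigma> + (if k < i then 0 else 1)" 
      if "\<sigma> \<in> av_perms m i k" for \<sigma>
      using that i k unfolding mem_av_perms[OF m] by force
    then show "(\<Sum>\<sigma>\<in>av_perms m i k. q ^ desc (i # Suc m # tl \<sigma>)) =
        (if k < i then 1 else q) * a q m i k"
      by (simp add: a_def sum_distrib_left)
  qed
  \<comment> \<open>The weight 1 of the terms with \<open>k < i\<close> is split as
    \<open>q + (1 - q)\<close>, so that the parts with \<open>q\<close> add up to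
    \<open>q * F q m i\<close>.\<close>
  also have "\<dots> = (\<Sum>k=1..m. q * a q m i k + (if k < i then (1 - q) * a q m i k else 0))"
    by (intro sum.cong) (auto simp: algebra_simps)
  also have "\<dots> = q * F q m i + (1 - q) * (\<Sum>k=1..m. if k < i then a q m i k else 0)"
    unfolding sum.distrib F_eq_sum_a[OF m] sum_distrib_left
    by (intro arg_cong2[of _ _ _ _ "(+)"] refl sum.cong) auto
  also have "(\<Sum>k=1..m. if k < i then a q m i k else 0) = (\<Sum>k=1..<i. a q m i k)"
    using i by (intro sum.mono_neutral_cong_right) auto
  also have "\<dots> = (\<Sum>k=1..<i. q * F q (m - 1) k)"
    using a_descent[of i "m - 1" _ q] i m by (intro sum.cong) auto
  finally show ?thesis by (simp add: sum_distrib_left mult.assoc)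
qed

section \<open>The generating functions\<close>

text \<open>A first entry \<open>m\<close> is the largest, so it is followed by a descent and can be
  deleted. For \<open>m = 1\<close> the sum is empty and the only permutation contributes 1.\<close>

lemma F_diag:
  assumes "1 \<le> m"
  shows "F q m m = (if m = 1 then 1 else 0) + q * (\<Sum>k=1..m-1. F q (m - 1) k)"
proof (cases "m = 1")
  case True
  then show ?thesis by (simp add: F_1_1[simplified])
next
  case False
  with assms have m: "2 \<le> m" "{1..m} = insert m {1..m-1}" by auto
  have "F q m m = (\<Sum>j=1..m. a q m m j)" by (rule F_eq_sum_a[OF m(1)])
  also have "\<dots> = (\<Sum>j=1..m-1. a q m m j)"
    using m(1) unfolding m(2) by (subst sum.insert) (auto simp: a_diag)
  also have "\<dots> = (\<Sum>k=1..m-1. q * F q (m - 1) k)"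
    using a_descent[of m "m - 1" _ q] m(1) by (intro sum.cong) auto
  finally show ?thesis using False by (simp add: sum_distrib_left)
qed

text \<open>For \<open>i = m\<close> the second entry \<open>m + 1\<close> is also
  \<open>i + 1\<close>; the condition \<open>i < m\<close> keeps it from being counted
  twice.\<close>

lemma a_eq:
  assumes i: "i \<in> {1..Suc m}" and j: "j \<in> {1..Suc m}" and m: "1 \<le> m"
  shows "a q (Suc m) i j = (if j < i then q * F q m j else 0) + (if j = Suc i then F q m i else 0)
    + (if j = Suc m \<and> i < m then q * F q m i + (1 - q) * q * (\<Sum>k=1..<i. F q (m - 1) k) else 0)"
proof -
  consider "j < i" | "j = i" | "j = Suc i" | "Suc i < j" "j < Suc m" | "Suc i < j" "j = Suc m"
    using j by fastforce
  then show ?thesis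
  proof cases
    case 1
    then show ?thesis using i m by (auto simp: a_descent)
  next
    case 2
    then show ?thesis using i m by (auto simp: a_diag)
  next
    case 3
    then show ?thesis using i j by (auto simp: a_succ)
  next
    case 4
    then show ?thesis using m by (auto simp: a_middle)
  next
    case 5
    then show ?thesis using i a_max[of i m q] by auto
  qed
qed

text \<open>On the left, \<open>h k\<close> is multiplied by the geometric sum of
  \<open>v ^ i\<close> over \<open>k < i \<le> n\<close>; the factor \<open>1 - v\<close> evaluates
  it without a division.\<close>

lemma sum_partial_sums_power:
  fixes v :: "'a::comm_ring_1"
  shows "(1 - v) * (\<Sum>i=1..n. v ^ i * (\<Sum>k=1..<i. h k)) = (\<Sum>k=1..n. h k * (v ^ Suc k - v ^ Suc n))"
proof (induction n)
  case (Suc n)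
  have s: "{1..<Suc n} = {1..n}" by auto
  have last: "sum g {1..Suc n} = sum g {1..n} + g (Suc n)" for g :: "nat \<Rightarrow> 'a" by simp
  have "(1 - v) * (\<Sum>i=1..Suc n. v ^ i * (\<Sum>k=1..<i. h k)) =
      (\<Sum>k=1..n. h k * (v ^ Suc k - v ^ Suc n)) + (1 - v) * v ^ Suc n * (\<Sum>k=1..n. h k)"
    unfolding last s distrib_left Suc by (simp only: mult.assoc)
  also have "\<dots> = (\<Sum>k=1..n. h k * (v ^ Suc k - v ^ Suc n) + (1 - v) * v ^ Suc n * h k)"
    by (simp add: sum.distrib sum_distrib_left)
  also have "\<dots> = (\<Sum>k=1..n. h k * (v ^ Suc k - v ^ Suc (Suc n)))"
    by (intro sum.cong) (auto simp: algebra_simps)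
  finally show ?case by simp
qed simp

section \<open>Summing the recurrence over both entries\<close>

definition first_poly :: "'a::comm_ring_1 \<Rightarrow> nat \<Rightarrow> 'a \<Rightarrow> 'a" where
  "first_poly q n v = (\<Sum>i=1..n. F q n i * v ^ i)"

lemma first_poly_0 [simp]: "first_poly q 0 v = 0"
  by (simp add: first_poly_def)

lemma first_poly_1 [simp]: "first_poly q (Suc 0) v = v"
  using F_1_1[of q] by (simp add: first_poly_def)

lemma first_poly_eq_sum_a:
  assumes "2 \<le> n"
  shows "first_poly q n v = (\<Sum>i=1..n. \<Sum>j=1..n. a q n i j * v ^ i * 1 ^ j)"
  by (simp add: first_poly_def F_eq_sum_a[OF assms] sum_distrib_right)

lemma row_sum:
  assumes i: "i \<in> {1..Suc m}" and m: "1 \<le> m"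
  shows "(\<Sum>j=1..Suc m. a q (Suc m) i j * w ^ j) =
    q * (\<Sum>j=1..<i. F q m j * w ^ j) + F q m i * w ^ Suc i
    + w ^ Suc m * (if i < m then q * F q m i + (1 - q) * q * (\<Sum>k=1..<i. F q (m - 1) k) else 0)"
proof -
  define X where "X = q * F q m i + (1 - q) * q * (\<Sum>k=1..<i. F q (m - 1) k)"
  have "(\<Sum>j=1..Suc m. a q (Suc m) i j * w ^ j) =
      (\<Sum>j=1..Suc m. (if j < i then q * F q m j * w ^ j else 0)
        + (if j = Suc i then F q m i * w ^ Suc i else 0)
        + (if j = Suc m then w ^ Suc m * (if i < m then X else 0) else 0))"
  proof (rule sum.cong[OF refl])
    fix j assume "j \<in> {1..Suc m}"
    from a_eq[OF i this m, of q, folded X_def]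
    show "a q (Suc m) i j * w ^ j = (if j < i then q * F q m j * w ^ j else 0)
        + (if j = Suc i then F q m i * w ^ Suc i else 0)
        + (if j = Suc m then w ^ Suc m * (if i < m then X else 0) else 0)"
      by (auto simp: algebra_simps)
  qed
  also have "\<dots> = (\<Sum>j=1..Suc m. if j < i then q * F q m j * w ^ j else 0)
        + (if Suc i \<in> {1..Suc m} then F q m i * w ^ Suc i else 0)
        + w ^ Suc m * (if i < m then X else 0)"
    unfolding sum.distrib by (subst sum.delta, simp)+ simp
  also have "(if Suc i \<in> {1..Suc m} then F q m i * w ^ Suc i else 0) = F q m i * w ^ Suc i"
    using F_outside[of i m q] by auto
  also have "(\<Sum>j=1..Suc m. if j < i then q * F q m j * w ^ j else 0) =
      (\<Sum>j=1..<i. q * F q m j * w ^ j)"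
    using i by (intro sum.mono_neutral_cong_right) auto
  finally show ?thesis by (simp add: X_def sum_distrib_left mult.assoc)
qed

lemma sum_a_recurrence:
  fixes q v w :: "'a::comm_ring_1"
  assumes m: "1 \<le> m"
  shows "(1 - v) * (\<Sum>i=1..Suc m. \<Sum>j=1..Suc m. a q (Suc m) i j * v ^ i * w ^ j) =
    q * (v * first_poly q m (v * w) - v ^ (m + 2) * first_poly q m w)
    + (1 - v) * w * first_poly q m (v * w)
    + w ^ Suc m * ((1 - v) * q * (first_poly q m v - v ^ m * F q m m)
       + (1 - q) * q * (v * first_poly q (m - 1) v - v ^ m * first_poly q (m - 1) 1))"
proof -
  have out: "F q m (Suc m) = 0" by (simp add: F_outside)
  have "(\<Sum>i=1..Suc m. \<Sum>j=1..Suc m. a q (Suc m) i j * v ^ i * w ^ j) =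
      (\<Sum>i=1..Suc m. v ^ i * (\<Sum>j=1..Suc m. a q (Suc m) i j * w ^ j))"
    by (simp only: sum_distrib_left mult_ac)
  also have "\<dots> = (\<Sum>i=1..Suc m. q * (v ^ i * (\<Sum>j=1..<i. F q m j * w ^ j))
      + w * (F q m i * (v * w) ^ i)
      + (if i < m then w ^ Suc m * (q * (F q m i * v ^ i)
           + (1 - q) * q * (v ^ i * (\<Sum>k=1..<i. F q (m - 1) k))) else 0))"
    by (rule sum.cong[OF refl], subst row_sum[OF _ m])
       (auto simp: algebra_simps power_mult_distrib)
  also have "\<dots> = q * (\<Sum>i=1..Suc m. v ^ i * (\<Sum>j=1..<i. F q m j * w ^ j))
      + w * (\<Sum>i=1..Suc m. F q m i * (v * w) ^ i)
      + (\<Sum>i=1..Suc m. if i < m then w ^ Suc m * (q * (F q m i * v ^ i)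
           + (1 - q) * q * (v ^ i * (\<Sum>k=1..<i. F q (m - 1) k))) else 0)"
    by (simp only: sum.distrib sum_distrib_left)
  also have "(\<Sum>i=1..Suc m. F q m i * (v * w) ^ i) = first_poly q m (v * w)"
    by (simp add: first_poly_def out)
  also have "(\<Sum>i=1..Suc m. if i < m then w ^ Suc m * (q * (F q m i * v ^ i)
           + (1 - q) * q * (v ^ i * (\<Sum>k=1..<i. F q (m - 1) k))) else 0) =
      (\<Sum>i=1..m-1. w ^ Suc m * (q * (F q m i * v ^ i)
           + (1 - q) * q * (v ^ i * (\<Sum>k=1..<i. F q (m - 1) k))))"
    by (intro sum.mono_neutral_cong_right) auto
  also have "\<dots> = w ^ Suc m * (q * (\<Sum>i=1..m-1. F q m i * v ^ i)
           + (1 - q) * q * (\<Sum>i=1..m-1. v ^ i * (\<Sum>k=1..<i. F q (m - 1) k)))"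
    by (simp only: sum.distrib sum_distrib_left[symmetric])
  \<comment> \<open>The formula for the second entry \<open>m + 1\<close> is applied for
    \<open>i < m\<close>, so the term \<open>i = m\<close> is taken out of the full sum.\<close>
  also have "(\<Sum>i=1..m-1. F q m i * v ^ i) = first_poly q m v - v ^ m * F q m m"
    using m by (cases m) (auto simp: first_poly_def)
  finally have eq: "(\<Sum>i=1..Suc m. \<Sum>j=1..Suc m. a q (Suc m) i j * v ^ i * w ^ j) =
      q * (\<Sum>i=1..Suc m. v ^ i * (\<Sum>j=1..<i. F q m j * w ^ j)) + w * first_poly q m (v * w)
      + w ^ Suc m * (q * (first_poly q m v - v ^ m * F q m m)
           + (1 - q) * q * (\<Sum>i=1..m-1. v ^ i * (\<Sum>k=1..<i. F q (m - 1) k)))"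
    (is "_ = q * ?S1 + _ + _ * (_ + _ * ?S2)") .
  \<comment> \<open>The outer sum runs to \<open>m + 1\<close>, whence the exponent
    \<open>m + 2\<close>; the summand with \<open>k = m + 1\<close> vanishes.\<close>
  have "(1 - v) * ?S1 = (\<Sum>k=1..m. F q m k * w ^ k * (v ^ Suc k - v ^ (m + 2)))"
    unfolding sum_partial_sums_power by (simp add: out)
  also have "\<dots> = v * first_poly q m (v * w) - v ^ (m + 2) * first_poly q m w"
    by (simp add: first_poly_def sum_distrib_left sum_subtractf algebra_simps power_mult_distrib)
  finally have S1: "(1 - v) * ?S1 = v * first_poly q m (v * w) - v ^ (m + 2) * first_poly q m w" .
  have "(1 - v) * ?S2 = (\<Sum>k=1..m-1. F q (m - 1) k * (v ^ Suc k - v ^ m))"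
    unfolding sum_partial_sums_power using m by simp
  also have "\<dots> = v * first_poly q (m - 1) v - v ^ m * first_poly q (m - 1) 1"
    by (simp add: first_poly_def sum_distrib_left sum_subtractf algebra_simps)
  finally have S2: "(1 - v) * ?S2 = v * first_poly q (m - 1) v - v ^ m * first_poly q (m - 1) 1" .
  have "(1 - v) * (q * ?S1 + w * first_poly q m (v * w)
        + w ^ Suc m * (q * (first_poly q m v - v ^ m * F q m m) + (1 - q) * q * ?S2)) =
      q * ((1 - v) * ?S1) + (1 - v) * w * first_poly q m (v * w)
        + w ^ Suc m * ((1 - v) * q * (first_poly q m v - v ^ m * F q m m)
        + (1 - q) * q * ((1 - v) * ?S2))"
    by (simp only: algebra_simps)
  then show ?thesis unfolding eq S1 S2 .
qed

section \<open>Power series and the functional equation\<close>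

definition Psi :: "'a::comm_ring_1 \<Rightarrow> 'a \<Rightarrow> 'a fps" where
  "Psi q v = Abs_fps (\<lambda>n. first_poly q n v)"

lemma Psi_nth [simp]: "fps_nth (Psi q v) n = first_poly q n v"
  by (simp add: Psi_def)

lemma A_1: "A q v 1 = Psi q v - fps_const v * fps_X"
proof (rule fps_ext)
  fix n :: nat
  consider "n = 0" | "n = 1" | "2 \<le> n" by linarith
  then show "fps_nth (A q v 1) n = fps_nth (Psi q v - fps_const v * fps_X) n"
    by cases (auto simp: A_def first_poly_eq_sum_a)
qed

lemma fps_nth_dilate: "fps_nth (f oo (fps_const c * fps_X)) n = c ^ n * fps_nth f n"
  for f :: "'a::comm_ring_1 fps"
  by (simp add: fps_compose_linear)

text \<open>Coefficientwise this is the summed recurrence with \<open>n = m + 1\<close>: factors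
  \<open>X\<close> shift the index, and powers of \<open>v\<close> and \<open>w\<close> with
  exponents depending on \<open>m\<close> become dilations.\<close>

lemma A_functional_equation:
  fixes q v w :: "'a::comm_ring_1"
  defines "X \<equiv> fps_X :: 'a fps"
  shows "fps_const (1 - v) * A q v w =
    fps_const (q * v) * (X * Psi q (v * w))
    - fps_const (q * v\<^sup>2) * (X * (Psi q w oo (fps_const v * X)))
    + fps_const ((1 - v) * w) * (X * Psi q (v * w))
    + fps_const ((1 - v) * q * w) * (X * (Psi q v oo (fps_const w * X)))
    - fps_const ((1 - v) * q * v * w\<^sup>2) * (X * X)
    - fps_const ((1 - v) * q\<^sup>2 * v * w\<^sup>2) * (X * (X * (Psi q 1 oo (fps_const (v * w) * X))))
    + fps_const ((1 - q) * q * v * w\<^sup>2) * (X * (X * (Psi q v oo (fps_const w * X))))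
    - fps_const ((1 - q) * q * v * w\<^sup>2) * (X * (X * (Psi q 1 oo (fps_const (v * w) * X))))"
  (is "?L = ?R")
proof (rule fps_ext)
  fix n :: nat
  consider "n = 0" | "n = 1" | m where "n = Suc m" "1 \<le> m"
    by (cases n) (auto, metis Suc_le_eq gr0I)
  then show "fps_nth ?L n = fps_nth ?R n"
  proof cases
    case 1
    then show ?thesis by (simp add: A_def X_def)
  next
    case 2
    then show ?thesis by (simp add: A_def X_def fps_nth_dilate)
  next
    case 3
    then obtain l where l: "m = Suc l" by (cases m) auto
    \<comment> \<open>In the term with \<open>F q m m\<close>, the 1 for \<open>m = 1\<close> yields
      the isolated multiple of \<open>X * X\<close>, and the rest yields a multiple of
      \<open>Psi q 1\<close> at \<open>vwx\<close>.\<close>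
    have d: "F q m m = (if l = 0 then 1 else 0) + q * first_poly q l 1"
      using F_diag[OF 3(2), of q] l by (simp add: first_poly_def)
    have "fps_nth ?L n = (1 - v) * (\<Sum>i=1..Suc m. \<Sum>j=1..Suc m. a q (Suc m) i j * v ^ i * w ^ j)"
      using 3 by (simp add: A_def)
    also have "\<dots> = fps_nth ?R n"
      unfolding sum_a_recurrence[OF 3(2)] d 3(1)
      by (simp add: l X_def fps_nth_dilate)
         (auto simp: algebra_simps power_mult_distrib power2_eq_square)
    finally show ?thesis .
  qed
qed

section \<open>The kernel method\<close>

text \<open>For \<open>w = 1\<close> all series except \<open>Psi q 1\<close> at \<open>vx\<close>
  become \<open>Psi q v\<close> and collect into one product with the kernel. The ring is arbitrary
  so that its elements may later be power series themselves.\<close>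

lemma kernel_equation:
  fixes q v :: "'a::comm_ring_1"
  defines "X \<equiv> fps_X :: 'a fps" and "Q \<equiv> fps_const q" and "V \<equiv> fps_const v"
  shows "(V * Q^2 * X^2 - V * Q * X^2 - Q * X + V * X - V - X + 1) * Psi q v =
    (1 - V) * V * X * (1 - Q * X)
    - Q * X * V * (V + X - V * Q * X) * (Psi q 1 oo (V * X))"
proof -
  have c: "fps_const (1 - u) = 1 - fps_const u" "fps_const (u * u') = fps_const u * fps_const u'"
    "fps_const (u ^ k) = fps_const u ^ k" for u u' :: 'a and k
    by simp_all (metis fps_const_1_eq_1 fps_const_sub)
  have "f oo (fps_const 1 * fps_X) = f" for f :: "'a fps" by simp
  then have "(1 - V) * (Psi q v - V * X) =
      Q * V * (X * Psi q v) - Q * V^2 * (X * (Psi q 1 oo (V * X)))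
      + (1 - V) * (X * Psi q v) + (1 - V) * Q * (X * Psi q v) - (1 - V) * Q * V * (X * X)
      - (1 - V) * Q^2 * V * (X * (X * (Psi q 1 oo (V * X))))
      + (1 - Q) * Q * V * (X * (X * Psi q v))
      - (1 - Q) * Q * V * (X * (X * (Psi q 1 oo (V * X))))"
    using A_functional_equation[of v q 1]
    by (simp only: A_1 X_def Q_def V_def mult_1_right power_one c)
  then show ?thesis by (simp add: algebra_simps power2_eq_square)
qed

text \<open>The substitution \<open>z = x\<close> in a series in \<open>z\<close> over the ring of series in \<open>x\<close>.\<close>

definition diag :: "'a::comm_ring_1 fps fps \<Rightarrow> 'a fps" where
  "diag f = Abs_fps (\<lambda>m. \<Sum>k\<le>m. fps_nth (fps_nth f k) (m - k))"

lemma diag_add: "diag (f + g) = diag f + diag g"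
  by (simp add: diag_def fps_eq_iff sum.distrib)

lemma diag_diff: "diag (f - g) = diag f - diag g"
  by (simp add: diag_def fps_eq_iff sum_subtractf)

text \<open>Coefficient \<open>m\<close> depends only on the terms up to \<open>z ^ m\<close>, so
  the substitution can be replaced by a finite sum, to which ordinary multiplication
  applies.\<close>

lemma diag_nth_partial_sum:
  assumes "m \<le> N"
  shows "fps_nth (diag f) m = fps_nth (\<Sum>k\<le>N. fps_nth f k * fps_X ^ k) m"
proof -
  have "fps_nth (\<Sum>k\<le>N. fps_nth f k * fps_X ^ k) m =
      (\<Sum>k\<le>N. if m < k then 0 else fps_nth (fps_nth f k) (m - k))"
    by (simp add: fps_sum_nth fps_X_power_mult_right_nth)
  also have "\<dots> = (\<Sum>k\<le>m. fps_nth (fps_nth f k) (m - k))"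
    using assms by (intro sum.mono_neutral_cong_right) auto
  finally show ?thesis by (simp add: diag_def)
qed

lemma diag_const_mult: "diag (fps_const c * f) = c * diag f"
proof (rule fps_ext)
  fix m
  define S where "S = (\<Sum>k\<le>m. fps_nth f k * fps_X ^ k)"
  have "fps_nth (c * diag f) m = fps_nth (c * S) m"
    unfolding fps_mult_nth S_def by (intro sum.cong refl) (simp add: diag_nth_partial_sum[of _ m])
  also have "c * S = (\<Sum>k\<le>m. fps_nth (fps_const c * f) k * fps_X ^ k)"
    by (simp add: S_def sum_distrib_left mult.assoc)
  finally show "fps_nth (diag (fps_const c * f)) m = fps_nth (c * diag f) m"
    by (simp add: diag_nth_partial_sum[of m m])
qed

lemma diag_X_mult: "diag (fps_X * f) = fps_X * diag f"
proof (rule fps_ext)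
  show "fps_nth (diag (fps_X * f)) m = fps_nth (fps_X * diag f) m" for m
    by (cases m) (simp_all add: diag_def sum.atMost_Suc_shift del: sum.atMost_Suc)
qed

lemma diag_const: "diag (fps_const c) = c"
  by (rule fps_ext) (simp add: diag_def sum.delta if_distrib[of "\<lambda>f. fps_nth f _"] cong: if_cong)

lemma diag_X: "diag fps_X = fps_X"
  by (metis diag_X_mult diag_const fps_const_1_eq_1 mult.right_neutral)

lemma diag_mult_const: "diag (f * fps_const c) = c * diag f"
  by (metis diag_const_mult mult.commute)

lemma diag_mult_X: "diag (f * (fps_X * g)) = fps_X * diag (f * g)"
  by (metis diag_X_mult mult.left_commute)

lemma first_poly_fps_const: "first_poly (fps_const q) n (fps_const v) = fps_const (first_poly q n v)"
proof -
  have s: "(\<Sum>i\<in>I. fps_const (g i)) = fps_const (sum g I)" for g :: "'b \<Rightarrow> 'a" and I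
    by (induction I rule: infinite_finite_induct) simp_all
  show ?thesis by (simp add: first_poly_def F_def s)
qed

text \<open>Setting \<open>z = x\<close> in \<open>S(uz)\<close> turns a dilation by the constant
  \<open>u\<close> of the larger ring into a composition with \<open>xu\<close>.\<close>

lemma diag_Psi_dilate:
  "diag (Psi (fps_const q) 1 oo (fps_const u * fps_X)) = Psi q 1 oo (u * fps_X)"
proof (rule fps_ext)
  fix m
  have c: "first_poly (fps_const q) k 1 = fps_const (first_poly q k 1)" for k
    using first_poly_fps_const[of q k 1] by simp
  show "fps_nth (diag (Psi (fps_const q) 1 oo (fps_const u * fps_X))) m =
      fps_nth (Psi q 1 oo (u * fps_X)) m"
    unfolding diag_def fps_nth_Abs_fps fps_nth_dilate fps_compose_nth[of _ "u * fps_X"] atMost_atLeast0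
    by (simp add: c power_mult_distrib fps_X_power_mult_right_nth mult.commute[of _ "fps_const _"])
qed

text \<open>The root depends on \<open>x\<close>, whereas \<open>v\<close> in the kernel equation is
  a constant. So that equation is taken in a new variable \<open>z\<close> over the ring of series
  in \<open>x\<close>, with \<open>u\<close> for \<open>v\<close>, and then \<open>z = x\<close> is
  substituted.\<close>

lemma kernel_root:
  fixes q :: "'a::field"
  assumes q: "q \<noteq> 0"
  defines "X \<equiv> fps_X :: 'a fps" and "Q \<equiv> fps_const q"
  obtains u where "fps_nth u 0 = 1" "u * (1 - X + Q * X\<^sup>2 - Q\<^sup>2 * X\<^sup>2) = 1 - X - Q * X"
    "(1 - X) * (Psi q 1 oo (u * X)) = X"
proof -
  \<comment> \<open>As a polynomial in \<open>v\<close> the kernel is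
    \<open>1 - X - Q * X - v * b\<close>, and \<open>b\<close> is a unit.\<close>
  define b where "b = 1 - X + Q * X\<^sup>2 - Q\<^sup>2 * X\<^sup>2"
  define u where "u = (1 - X - Q * X) * inverse b"
  have b0: "fps_nth b 0 = 1" by (simp add: b_def X_def Q_def power2_eq_square)
  then have "b * inverse b = 1" by (simp add: inverse_mult_eq_1')
  then have ub: "u * b = 1 - X - Q * X" by (simp add: u_def mult.assoc mult.commute)
  have u0: "fps_nth u 0 = 1" using b0 by (simp add: u_def X_def Q_def)
  define S where "S = Psi q 1 oo (u * X)"
  \<comment> \<open>\<open>G\<close> is the unknown series at the root; it drops out because its
    factor, the kernel, vanishes there.\<close>
  define G where "G = diag (Psi Q u)"
  define D where "D = Psi Q 1 oo (fps_const u * fps_X)"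
  have "diag D = S" unfolding D_def S_def Q_def X_def by (rule diag_Psi_dilate)
  then have "(u * Q^2 * X^2 - u * Q * X^2 - Q * X + u * X - u - X + 1) * G =
      (1 - u) * u * X * (1 - Q * X) - Q * X * u * (u + X - u * Q * X) * S"
    using arg_cong[OF kernel_equation[of u Q, folded D_def], of diag]
    by (simp add: algebra_simps power2_eq_square diag_add diag_diff diag_const_mult diag_X_mult
        diag_const diag_X diag_mult_const diag_mult_X G_def X_def)
  moreover have "u * Q^2 * X^2 - u * Q * X^2 - Q * X + u * X - u - X + 1 = 0"
    using ub unfolding b_def by algebra
  ultimately have "(u * X) * (Q * (u + X - u * Q * X) * S) = (u * X) * ((1 - u) * (1 - Q * X))"
    by algebra
  moreover have "u \<noteq> 0" "X \<noteq> 0" using u0 by (auto simp: X_def)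
  ultimately have "Q * (u + X - u * Q * X) * S = (1 - u) * (1 - Q * X)" by simp
  \<comment> \<open>After multiplication by \<open>b\<close> and elimination of \<open>u\<close>,
    both sides contain the factor \<open>Q * (1 + X - Q * X) * (1 - Q * X)\<close>, which is nonzero
    because \<open>q \<noteq> 0\<close>.\<close>
  then have "Q * (1 + X - Q * X) * (1 - Q * X) * ((1 - X) * S) = Q * (1 + X - Q * X) * (1 - Q * X) * X"
    using ub unfolding b_def by algebra
  moreover have "Q * (1 + X - Q * X) * (1 - Q * X) \<noteq> 0"
  proof -
    have "fps_nth (1 + X - Q * X) 0 \<noteq> 0" "fps_nth (1 - Q * X) 0 \<noteq> 0" "Q \<noteq> 0"
      using q by (simp_all add: X_def Q_def)
    then show ?thesis by (metis fps_zero_nth no_zero_divisors)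
  qed
  ultimately have "(1 - X) * S = X" by simp
  with that u0 ub show ?thesis unfolding S_def b_def by blast
qed

text \<open>The relation is verified after composition with \<open>xu\<close>, where
  \<open>S\<close> becomes \<open>x / (1 - x)\<close>. Over a field, composition with a nonzero
  series without constant term is injective.\<close>

lemma Psi_1_quadratic:
  fixes q :: "'a::field"
  assumes q: "q \<noteq> 0"
  defines "X \<equiv> fps_X :: 'a fps" and "Q \<equiv> fps_const q"
  shows "(Q + Q * (1 - Q) * X) * (Psi q 1)\<^sup>2 - (1 - X) * Psi q 1 + X = 0"
proof -
  obtain u where u: "fps_nth u 0 = 1" "u * (1 - X + Q * X\<^sup>2 - Q\<^sup>2 * X\<^sup>2) = 1 - X - Q * X"
    "(1 - X) * (Psi q 1 oo (u * X)) = X"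
    using kernel_root[OF q] unfolding X_def Q_def by metis
  define S where "S = Psi q 1 oo (u * X)"
  have y0: "fps_nth (u * X) 0 = 0" by (simp add: X_def)
  let ?E = "(Q + Q * (1 - Q) * X) * (Psi q 1)\<^sup>2 - (1 - X) * Psi q 1 + X"
  have "?E oo (u * X) = (Q + Q * (1 - Q) * (u * X)) * S\<^sup>2 - (1 - u * X) * S + u * X"
    using y0 by (simp add: fps_compose_add_distrib fps_compose_sub_distrib fps_compose_mult_distrib
        fps_compose_power[symmetric] Q_def X_def S_def)
  \<comment> \<open>The factor in front clears the denominators of \<open>S\<^sup>2\<close> and of
    \<open>u\<close>.\<close>
  moreover have "(1 - X)\<^sup>2 * (1 - X + Q * X\<^sup>2 - Q\<^sup>2 * X\<^sup>2) *
      ((Q + Q * (1 - Q) * (u * X)) * S\<^sup>2 - (1 - u * X) * S + u * X) = 0"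
    using u(2,3) unfolding S_def[symmetric] by algebra
  moreover have "fps_nth ((1 - X)\<^sup>2 * (1 - X + Q * X\<^sup>2 - Q\<^sup>2 * X\<^sup>2)) 0 \<noteq> 0"
    by (simp add: X_def Q_def power2_eq_square)
  ultimately have "?E oo (u * X) = 0" by (metis fps_zero_nth no_zero_divisors)
  moreover have "fps_nth (u * X) 1 \<noteq> 0" using u(1) by (simp add: X_def)
  ultimately show ?thesis using fps_compose_eq_0_iff[OF y0] by force
qed

text \<open>Completing the square in the quadratic equation for \<open>Psi q 1\<close> shows that
  the square of the right-hand side is the discriminant; the constant term 1 fixes the sign.\<close>

lemma t_eq:
  fixes q :: "'a::field_char_0"
  defines "X \<equiv> fps_X :: 'a fps" and "Q \<equiv> fps_const q"
  shows "t q = 1 - X - 2 * Q * (1 + (1 - Q) * X) * Psi q 1"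
proof -
  define D where "D = fps_const ((1 - 2 * q)\<^sup>2) * fps_X\<^sup>2 - 2 * fps_X * fps_const (1 + 2 * q) + 1"
  have D0: "fps_nth D 0 = 1" by (simp add: D_def power2_eq_square)
  have "fps_const (1 - 2 * q) = 1 - 2 * Q" "fps_const (1 + 2 * q) = 1 + 2 * Q"
    by (simp_all add: Q_def numeral_fps_const flip: fps_const_1_eq_1)
  then have c: "fps_const ((1 - 2 * q)\<^sup>2) = (1 - 2 * Q)\<^sup>2" "fps_const (1 + 2 * q) = 1 + 2 * Q"
    by (metis fps_const_power)+
  have "(1 - X - 2 * Q * (1 + (1 - Q) * X) * Psi q 1)\<^sup>2 = D"
  \<comment> \<open>The quadratic equation was derived for \<open>q \<noteq> 0\<close>; for
    \<open>q = 0\<close> both sides are the square of \<open>1 - X\<close>.\<close>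
  proof (cases "q = 0")
    case True
    then show ?thesis unfolding D_def c by (simp add: Q_def X_def algebra_simps power2_eq_square)
  next
    case False
    from Psi_1_quadratic[OF this] show ?thesis
      unfolding D_def c X_def[symmetric] Q_def[symmetric] by algebra
  qed
  moreover have "fps_nth (1 - X - 2 * Q * (1 + (1 - Q) * X) * Psi q 1) 0 = 1"
    by (simp add: X_def Q_def)
  ultimately show ?thesis
    unfolding t_def D_def[symmetric] by (metis fps_sqrt_iff[OF D0])
qed

section \<open>Substitutions and removal of denominators\<close>

lemma unit_mult_divide_cancel:
  fixes f g :: "'a::field fps"
  assumes "fps_nth g 0 \<noteq> 0"
  shows "g * (f / g) = f"
  using assms by (simp add: fps_divide_unit inverse_mult_eq_1' mult.left_commute[of g])

text \<open>The first identity involves \<open>Psi q v\<close> at \<open>wx\<close> and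
  \<open>Psi q 1\<close> at \<open>vwx\<close>; the kernel equation at \<open>wx\<close> is the
  relation between them.\<close>

lemma kernel_equation_dilated:
  fixes q v w :: "'a::field"
  defines "X \<equiv> fps_X :: 'a fps" and "Q \<equiv> fps_const q" and "V \<equiv> fps_const v" and "W \<equiv> fps_const w"
  shows "(V * Q^2 * (W * X)^2 - V * Q * (W * X)^2 - Q * (W * X) + V * (W * X) - V - W * X + 1)
      * (Psi q v oo (W * X)) =
    (1 - V) * V * (W * X) * (1 - Q * (W * X))
    - Q * (W * X) * V * (V + W * X - V * Q * (W * X)) * (Psi q 1 oo (V * W * X))"
proof -
  have 0: "fps_nth (W * X) 0 = 0" "fps_nth (V * X) 0 = 0" by (simp_all add: X_def)
  have c: "Q oo g = Q" "V oo g = V" "W oo g = W" for g by (simp_all add: Q_def V_def W_def)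
  have "X oo (W * X) = W * X" using 0 by (simp add: X_def)
  moreover from this have "Psi q 1 oo (V * X) oo (W * X) = Psi q 1 oo (V * W * X)"
    using 0 by (simp add: fps_compose_assoc[symmetric] fps_compose_mult_distrib c mult.assoc)
  ultimately show ?thesis
    using arg_cong[OF kernel_equation[of v q], of "\<lambda>f. f oo (W * X)"] 0
    unfolding X_def[symmetric] Q_def[symmetric] V_def[symmetric]
    by (simp add: fps_compose_add_distrib fps_compose_sub_distrib fps_compose_mult_distrib
        fps_compose_power[symmetric] c)
qed

lemma t_dilated:
  fixes q v :: "'a::field_char_0"
  defines "X \<equiv> fps_X :: 'a fps" and "Q \<equiv> fps_const q" and "V \<equiv> fps_const v"
  shows "t q oo (X * V) = 1 - V * X - 2 * Q * (1 + (1 - Q) * (V * X)) * (Psi q 1 oo (V * X))"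
proof -
  have 0: "fps_nth (V * X) 0 = 0" by (simp add: X_def)
  have "Q oo g = Q" "(2 :: 'a fps) oo g = 2" for g 
    by (simp_all add: Q_def numeral_fps_const)
  moreover have "X oo (V * X) = V * X" using 0 by (simp add: X_def)
  ultimately show ?thesis
    unfolding t_eq X_def[symmetric] Q_def[symmetric] mult.commute[of X V]
    using 0 by (simp add: fps_compose_add_distrib fps_compose_sub_distrib fps_compose_mult_distrib)
qed

lemma A_1_dilated:
  fixes q v c :: "'a::field"
  shows "A q v 1 oo (fps_const c * fps_X) =
    (Psi q v oo (fps_const c * fps_X)) - fps_const v * (fps_const c * fps_X)"
  by (simp add: A_1 fps_compose_sub_distrib fps_compose_mult_distrib)

theorem theorem10:
  fixes q v w :: "'a::field_char_0" and x Q V W P :: "'a fps"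
  assumes "v \<noteq> 1"
  defines "x \<equiv> fps_X"
    and "Q \<equiv> fps_const q" and "V \<equiv> fps_const v" and "W \<equiv> fps_const w"
  defines "P \<equiv> V * Q^2 * x^2 - V * Q * x^2 - Q * x + V * x - V - x + 1"
  shows "A q v w =
      (W * x + V * Q * x / (1 - V)) * A q (v * w) 1
      - V^2 * Q * x / (1 - V) * (A q w 1 oo (V * x))
      + V * W^2 * Q * x^2 / ((1 - V) * (W * Q * x - 1)) * (A q 1 1 oo (V * W * x))
      - W^2 * Q * x^2 / ((1 - V) * (W * Q * x - 1)) * (A q v 1 oo (W * x))
      + (V * W * Q^2 * x - V * Q - W) * V * W * x^2 / (W * Q * x - 1)
    \<and> A q v 1 =
      x * V * (V * Q * x - V - x) * (t q oo (x * V)) / (2 * P * (V * Q * x - V * x - 1))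
      + (x + (Q * x^2 + Q * x + 3 * x^2 - 2 * x - 1) * V) * V * x
        / (2 * (V * Q * x - V * x - 1) * (V * Q * x - 1) * P)
      - (2 * Q^2 * x^2 + 3 * Q^2 * x - Q * x^2 - Q * x - 3 * Q + 2 * x - 1
          + (1 - 2 * Q) * (Q * x - 1) * V * Q * x) * V^3 * x^2
        / (2 * (V * Q * x - V * x - 1) * (V * Q * x - 1) * P)
      + V^2 * Q * x^2 / (1 - V * Q * x)"
proof (rule conjI)
  define D E R N where "D = V * Q * x - V * x - 1" and "E = V * Q * x - 1"
    and "R = W * Q * x - 1" and "N = 1 - V"
  \<comment> \<open>The constant terms are \<open>1 - v\<close> for \<open>P\<close> and
    \<open>N\<close> and \<open>-1\<close> for \<open>D\<close>, \<open>E\<close> and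
    \<open>R\<close>, so with \<open>v \<noteq> 1\<close> all denominators are units.\<close>
  have nth0: "fps_nth P 0 \<noteq> 0" "fps_nth D 0 \<noteq> 0" "fps_nth E 0 \<noteq> 0" "fps_nth R 0 \<noteq> 0"
    "fps_nth N 0 \<noteq> 0" "fps_nth (1 - V * Q * x) 0 \<noteq> 0" "fps_nth 2 0 \<noteq> (0::'a)"
    using assms(1)
    by (simp_all add: P_def D_def E_def R_def N_def x_def V_def Q_def W_def power2_eq_square)
  then have nonzero: "P \<noteq> 0" "D \<noteq> 0" "E \<noteq> 0" "R \<noteq> 0" "N \<noteq> 0" by auto

  define \<Psi> S where "\<Psi> = Psi q v" and "S = Psi q 1 oo (V * x)"
  have ker: "P * \<Psi> = N * V * x * (1 - Q * x) - Q * x * V * (V + x - V * Q * x) * S"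
    unfolding P_def N_def \<Psi>_def S_def V_def Q_def x_def by (rule kernel_equation)
  define T where "T = t q oo (x * V)"
  have T: "T = 1 - V * x - 2 * Q * (1 + (1 - Q) * (V * x)) * S"
    unfolding T_def S_def V_def Q_def x_def by (rule t_dilated)

  define n1 n2 n3 n4 where "n1 = x * V * (V * Q * x - V - x) * T"
    and "n2 = (x + (Q * x^2 + Q * x + 3 * x^2 - 2 * x - 1) * V) * V * x"
    and "n3 = (2 * Q^2 * x^2 + 3 * Q^2 * x - Q * x^2 - Q * x - 3 * Q + 2 * x - 1
          + (1 - 2 * Q) * (Q * x - 1) * V * Q * x) * V^3 * x^2"
    and "n4 = V^2 * Q * x^2"
  define y1 y2 y3 y4 where "y1 = n1 / (2 * P * D)" and "y2 = n2 / (2 * D * E * P)"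
    and "y3 = n3 / (2 * D * E * P)" and "y4 = n4 / (1 - V * Q * x)"
  have "2 * P * D * y1 = n1" "2 * D * E * P * y2 = n2" "2 * D * E * P * y3 = n3"
    "(1 - V * Q * x) * y4 = n4"
    unfolding y1_def y2_def y3_def y4_def
    using nth0 by (intro unit_mult_divide_cancel; simp)+
  \<comment> \<open>The last term changes its sign because \<open>1 - V * Q * x\<close> is
    \<open>- E\<close>.\<close>
  moreover have "2 * P * D * E * (y1 + y2 - y3 + y4) =
      E * (2 * P * D * y1) + 2 * D * E * P * y2 - 2 * D * E * P * y3
      - 2 * P * D * ((1 - V * Q * x) * y4)"
    unfolding E_def by (simp add: algebra_simps)
  ultimately have "2 * P * D * E * (y1 + y2 - y3 + y4) = E * n1 + n2 - n3 - 2 * P * D * n4"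
    by simp
  \<comment> \<open>With \<open>P * \<Psi>\<close> and \<open>T\<close> expressed by
    \<open>S\<close>, this is a polynomial identity in \<open>Q\<close>, \<open>V\<close>,
    \<open>x\<close> and \<open>S\<close>.\<close>
  also have "\<dots> = 2 * D * E * (P * \<Psi>) - 2 * P * D * E * (V * x)"
    unfolding ker n1_def n2_def n3_def n4_def T unfolding P_def D_def E_def N_def by algebra
  also have "\<dots> = 2 * P * D * E * (\<Psi> - V * x)" by (simp add: algebra_simps)
  finally have "\<Psi> - V * x = y1 + y2 - y3 + y4" using nonzero by simp
  moreover have "A q v 1 = \<Psi> - V * x" by (simp add: A_1 \<Psi>_def V_def x_def)
  ultimately show "A q v 1 =
      x * V * (V * Q * x - V - x) * (t q oo (x * V)) / (2 * P * (V * Q * x - V * x - 1))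
      + (x + (Q * x^2 + Q * x + 3 * x^2 - 2 * x - 1) * V) * V * x
        / (2 * (V * Q * x - V * x - 1) * (V * Q * x - 1) * P)
      - (2 * Q^2 * x^2 + 3 * Q^2 * x - Q * x^2 - Q * x - 3 * Q + 2 * x - 1
          + (1 - 2 * Q) * (Q * x - 1) * V * Q * x) * V^3 * x^2
        / (2 * (V * Q * x - V * x - 1) * (V * Q * x - 1) * P)
      + V^2 * Q * x^2 / (1 - V * Q * x)"
    unfolding y1_def y2_def y3_def y4_def n1_def n2_def n3_def n4_def T_def D_def E_def by simp

  define B1 B2 B3 B4 where "B1 = Psi q (v * w)" and "B2 = Psi q w oo (V * x)"
    and "B3 = Psi q 1 oo (V * W * x)" and "B4 = Psi q v oo (W * x)"
  have c: "fps_const (1 - u) = 1 - fps_const u" "fps_const (u * u') = fps_const u * fps_const u'"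
    "fps_const (u ^ k) = fps_const u ^ k" for u u' :: 'a and k
    by simp_all (metis fps_const_1_eq_1 fps_const_sub)
  have fe: "N * A q v w = Q * V * (x * B1) - Q * V^2 * (x * B2) + N * W * (x * B1)
      + N * Q * W * (x * B4) - N * Q * V * W^2 * (x * x) - N * Q^2 * V * W^2 * (x * (x * B3))
      + (1 - Q) * Q * V * W^2 * (x * (x * B4)) - (1 - Q) * Q * V * W^2 * (x * (x * B3))"
    using A_functional_equation[of v q w]
    unfolding c x_def[symmetric] Q_def[symmetric] V_def[symmetric] W_def[symmetric]
      N_def[symmetric] B1_def[symmetric] B2_def[symmetric] B3_def[symmetric] B4_def[symmetric] .
  have ker': "(V * Q^2 * (W * x)^2 - V * Q * (W * x)^2 - Q * (W * x) + V * (W * x) - V - W * x + 1)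
      * B4 = N * V * (W * x) * (1 - Q * (W * x))
      - Q * (W * x) * V * (V + W * x - V * Q * (W * x)) * B3"
    unfolding N_def B3_def B4_def V_def Q_def W_def x_def by (rule kernel_equation_dilated)
  have A: "A q (v * w) 1 = B1 - V * W * x" "A q w 1 oo (V * x) = B2 - W * (V * x)"
    "A q 1 1 oo (V * W * x) = B3 - V * W * x" "A q v 1 oo (W * x) = B4 - V * (W * x)"
    using A_1_dilated[of q w v] A_1_dilated[of q 1 "v * w"] A_1_dilated[of q v w]
    by (simp_all add: A_1 B1_def B2_def B3_def B4_def V_def W_def x_def)
  define z1 z2 z3 z4 z5 where "z1 = V * Q * x / N" and "z2 = V^2 * Q * x / N"
    and "z3 = V * W^2 * Q * x^2 / (N * R)" and "z4 = W^2 * Q * x^2 / (N * R)"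
    and "z5 = (V * W * Q^2 * x - V * Q - W) * V * W * x^2 / R"
  have z: "N * z1 = V * Q * x" "N * z2 = V^2 * Q * x"
    "N * R * z3 = V * W^2 * Q * x^2" "N * R * z4 = W^2 * Q * x^2"
    "R * z5 = (V * W * Q^2 * x - V * Q - W) * V * W * x^2"
    unfolding z1_def z2_def z3_def z4_def z5_def
    using nth0 by (intro unit_mult_divide_cancel; simp)+
  have "N * R * ((W * x + z1) * (B1 - V * W * x) - z2 * (B2 - W * (V * x))
      + z3 * (B3 - V * W * x) - z4 * (B4 - V * (W * x)) + z5) =
    R * (N * W * x + N * z1) * (B1 - V * W * x) - R * (N * z2) * (B2 - W * (V * x))
      + N * R * z3 * (B3 - V * W * x) - N * R * z4 * (B4 - V * (W * x)) + N * (R * z5)"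
    by (simp add: algebra_simps)
  \<comment> \<open>The coefficients of \<open>B1\<close> and \<open>B2\<close> agree on both sides;
    the remaining difference is, up to sign, \<open>Q * W * x\<close> times the difference of the
    two sides of \<open>ker'\<close>.\<close>
  also have "\<dots> = R * (N * A q v w)"
    unfolding z fe using ker' unfolding R_def N_def by algebra
  finally have "N * R * ((W * x + z1) * (B1 - V * W * x) - z2 * (B2 - W * (V * x))
      + z3 * (B3 - V * W * x) - z4 * (B4 - V * (W * x)) + z5) = N * R * A q v w"
    by (simp add: mult_ac)
  then have "(W * x + z1) * (B1 - V * W * x) - z2 * (B2 - W * (V * x))
      + z3 * (B3 - V * W * x) - z4 * (B4 - V * (W * x)) + z5 = A q v w"
    using nonzero by simp
  then show "A q v w =
      (W * x + V * Q * x / (1 - V)) * A q (v * w) 1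
      - V^2 * Q * x / (1 - V) * (A q w 1 oo (V * x))
      + V * W^2 * Q * x^2 / ((1 - V) * (W * Q * x - 1)) * (A q 1 1 oo (V * W * x))
      - W^2 * Q * x^2 / ((1 - V) * (W * Q * x - 1)) * (A q v 1 oo (W * x))
      + (V * W * Q^2 * x - V * Q - W) * V * W * x^2 / (W * Q * x - 1)"
    unfolding A z1_def z2_def z3_def z4_def z5_def N_def R_def by simp
qed

end
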